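(* Let $X$ and $Y$ be sets equipped with large scale structures, let $n\ge 1$ be an integer, and let $f:X\to Y$ be coarse and coarsely $n$-to-$1$. Suppose $f$ satisfies the following additional property: ($*$) For every uniformly bounded cover $\mathcal{U}$ of $Y$ there is a uniformly bounded cover $\mathcal{V}$ of $X$ such that for each element $U\in\mathcal{U}$ there exist $V_1,V_2,\ldots,V_n\in\mathcal{V}$ such that $st^n(f(V_i),f(\mathcal{V}))\supset U$ for each $1\le i\le n$. If $X$ is metrizable, then $Y$ is metrizable.
   Context: For a set $X$, a subset $A\subset X$ and a family $\mathcal{V}$ of subsets of $X$, the star is $st(A,\mathcal{V})=\bigcup\{V\in\mathcal{V}: V\cap A\neq\emptyset\}$; inductively $st^1(A,\mathcal{V})=st(A,\mathcal{V})$ and $st^n(A,\mathcal{V})=st(st^{n-1}(A,\mathcal{V}),\mathcal{V})$. For two families, $st(\mathcal{U},\mathcal{V})=\{st(U,\mathcal{V}):U\in\mathcal{U}\}$. A family $\mathcal{V}$ refines a family $\mathcal{U}$ if each element of $\mathcal{V}$ is contained in some element of $\mathcal{U}$. For a family $\mathcal{V}$ of subsets of $X$, $f(\mathcal{V})=\{f(V):V\in\mathcal{V}\}$. A large scale structure on a set $X$ (equivalent to a coarse structure in the sense of Roe) is a nonempty set $\mathcal{LSS}_X$ of covers of $X$ that is closed under refinements (every cover of $X$ refining a member is a member) and such that $\mathcal{B}_1,\mathcal{B}_2\in\mathcal{LSS}_X$ implies $st(\mathcal{B}_1,\mathcal{B}_2)\in\mathcal{LSS}_X$. The members of $\mathcal{LSS}_X$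 are called uniformly bounded covers of $X$. A function $f:X\to Y$ is coarse if for every $\mathcal{B}_X\in\mathcal{LSS}_X$ there is $\mathcal{B}_Y\in\mathcal{LSS}_Y$ such that $f(\mathcal{B}_X)$ refines $\mathcal{B}_Y$. It is coarsely $n$-to-$1$ if for every uniformly bounded cover $\mathcal{U}_Y$ of $Y$ there is a uniformly bounded cover $\mathcal{U}_X$ of $X$ such that for every $B\in\mathcal{U}_Y$ there exist (not necessarily distinct) $B_1,\ldots,B_n\in\mathcal{U}_X$ with $f^{-1}(B)\subset\bigcup_{i=1}^nB_i$. A large scale structure is metrizable if there is an $\infty$-metric (a metric allowed to take the value $\infty$) on the set such that the uniformly bounded covers are exactly the covers by sets whose diameters are bounded by a common finite constant. *)

theory Defs
  imports "HOL-Library.FuncSet" "HOL-Library.Extended_Nonnegative_Real"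
begin

text \<open>The underlying sets are explicit carriers \<open>X :: 'a set\<close>, possibly empty; the members of a
  cover of \<open>X\<close> are subsets of \<open>X\<close>.\<close>

definition star :: "'a set \<Rightarrow> 'a set set \<Rightarrow> 'a set" where
  "star A \<V> = \<Union>{V \<in> \<V>. V \<inter> A \<noteq> {}}"

text \<open>Only exponents \<open>n \<ge> 1\<close> matter; the value at \<open>0\<close> is chosen such that \<open>n = 1\<close> gives
  \<open>star A \<V>\<close>.\<close>

primrec star_iter :: "nat \<Rightarrow> 'a set \<Rightarrow> 'a set set \<Rightarrow> 'a set" where
  "star_iter 0 A \<V> = A"
| "star_iter (Suc n) A \<V> = star (star_iter n A \<V>) \<V>"

definition star_family :: "'a set set \<Rightarrow> 'a set set \<Rightarrow> 'a set set" where
  "star_family \<U> \<V> = (\<lambda>U. star U \<V>) ` \<U>"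

definition refines :: "'a set set \<Rightarrow> 'a set set \<Rightarrow> bool" where
  "refines \<V> \<U> \<longleftrightarrow> (\<forall>V\<in>\<V>. \<exists>U\<in>\<U>. V \<subseteq> U)"

definition image_family :: "('a \<Rightarrow> 'b) \<Rightarrow> 'a set set \<Rightarrow> 'b set set" where
  "image_family f \<V> = (\<lambda>V. f ` V) ` \<V>"

definition cover_of :: "'a set \<Rightarrow> 'a set set \<Rightarrow> bool" where
  "cover_of X \<U> \<longleftrightarrow> \<Union>\<U> = X"

definition large_scale_structure :: "'a set \<Rightarrow> 'a set set set \<Rightarrow> bool" where
  "large_scale_structure X L \<longleftrightarrow>
     L \<noteq> {} \<and>
     (\<forall>\<B>\<in>L. cover_of X \<B>) \<and>
     (\<forall>\<B>\<in>L. \<forall>\<C>. cover_of X \<C> \<and> refines \<C> \<B> \<longrightarrow> \<C> \<in> L) \<and>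
     (\<forall>\<B>\<^sub>1\<in>L. \<forall>\<B>\<^sub>2\<in>L. star_family \<B>\<^sub>1 \<B>\<^sub>2 \<in> L)"

definition coarse_map :: "'a set set set \<Rightarrow> 'b set set set \<Rightarrow> ('a \<Rightarrow> 'b) \<Rightarrow> bool" where
  "coarse_map LX LY f \<longleftrightarrow> (\<forall>\<B>\<^sub>X\<in>LX. \<exists>\<B>\<^sub>Y\<in>LY. refines (image_family f \<B>\<^sub>X) \<B>\<^sub>Y)"

definition coarsely_n_to_1 ::
    "nat \<Rightarrow> 'a set \<Rightarrow> 'a set set set \<Rightarrow> 'b set set set \<Rightarrow> ('a \<Rightarrow> 'b) \<Rightarrow> bool" where
  "coarsely_n_to_1 n X LX LY f \<longleftrightarrow>
     (\<forall>\<U>\<^sub>Y\<in>LY. \<exists>\<U>\<^sub>X\<in>LX. \<forall>B\<in>\<U>\<^sub>Y. \<exists>C :: nat \<Rightarrow> 'a set.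
        (\<forall>i\<in>{1..n}. C i \<in> \<U>\<^sub>X) \<and> f -` B \<inter> X \<subseteq> (\<Union>i\<in>{1..n}. C i))"

definition infty_metric_on :: "'a set \<Rightarrow> ('a \<Rightarrow> 'a \<Rightarrow> ennreal) \<Rightarrow> bool" where
  "infty_metric_on X d \<longleftrightarrow>
     (\<forall>x\<in>X. \<forall>y\<in>X. d x y = 0 \<longleftrightarrow> x = y) \<and>
     (\<forall>x\<in>X. \<forall>y\<in>X. d x y = d y x) \<and>
     (\<forall>x\<in>X. \<forall>y\<in>X. \<forall>z\<in>X. d x z \<le> d x y + d y z)"

text \<open>The supremum is taken in \<open>ennreal\<close>, so the empty set has diameter \<open>0\<close>.\<close>

definition infty_diameter :: "('a \<Rightarrow> 'a \<Rightarrow> ennreal) \<Rightarrow> 'a set \<Rightarrow> ennreal" where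
  "infty_diameter d A = (SUP x\<in>A. SUP y\<in>A. d x y)"

definition lss_metrizable :: "'a set \<Rightarrow> 'a set set set \<Rightarrow> bool" where
  "lss_metrizable X L \<longleftrightarrow>
     (\<exists>d. infty_metric_on X d \<and>
        (\<forall>\<U>. \<U> \<in> L \<longleftrightarrow> cover_of X \<U> \<and> (\<exists>c<\<infinity>. \<forall>U\<in>\<U>. infty_diameter d U \<le> c)))"

end

theory Submission
  imports Defs
begin

text \<open>
  A large scale structure is metrizable as soon as it is countably generated: some sequence of
  uniformly bounded covers is cofinal with respect to refinement.  Given such a sequence, one builds
  recursively a cofinal sequence in which the star of each cover with itself refines the next one;
  the index of the first cover with an element that contains two given points then yields a metric,
  because composing two relations of level \<open>m\<close> costs only one further level
  (\<open>metric_of_levels\<close>, \<open>countably_generated_imp_metrizable\<close>).  Conversely, in a metrizable structure the covers by all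
  sets of diameter at most \<open>k\<close> are cofinal (\<open>metrizable_imp_countably_generated\<close>).

  So it suffices to carry a cofinal sequence \<open>C\<close> from \<open>X\<close> to \<open>Y\<close>.  As \<open>f\<close> is coarse,
  \<open>f(C k)\<close> refines some uniformly bounded \<open>B k\<close>, and the \<open>n\<close>-fold stars of the elements of
  \<open>B k\<close> with respect to \<open>B k\<close> form a uniformly bounded cover again (\<open>lss_star_iter\<close>).  The star
  property says that every uniformly bounded cover of \<open>Y\<close> refines the family of sets
  \<open>st\<^sup>n(f(V), f(\<V>))\<close>, \<open>V \<in> \<V>\<close>, for some uniformly bounded \<open>\<V>\<close>; as \<open>\<V>\<close> refines some \<open>C k\<close>,
  monotonicity of stars (\<open>star_iter_mono\<close>) shows that it refines the \<open>n\<close>-fold stars of \<open>B k\<close>.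
\<close>

section \<open>Stars and refinements\<close>

lemma star_mono:
  assumes "A \<subseteq> B" "refines \<V> \<W>"
  shows "star A \<V> \<subseteq> star B \<W>"
proof
  fix x assume "x \<in> star A \<V>"
  then obtain V where "V \<in> \<V>" "V \<inter> A \<noteq> {}" "x \<in> V" unfolding star_def by blast
  moreover then obtain W where "W \<in> \<W>" "V \<subseteq> W" using assms(2) unfolding refines_def by blast
  ultimately show "x \<in> star B \<W>" using assms(1) unfolding star_def by blast
qed

lemma star_iter_mono:
  assumes "A \<subseteq> B" "refines \<V> \<W>"
  shows "star_iter n A \<V> \<subseteq> star_iter n B \<W>"
  by (induction n) (simp_all add: assms star_mono)

lemma refines_trans: "refines \<U> \<V> \<Longrightarrow> refines \<V> \<W> \<Longrightarrow> refines \<U> \<W>"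
  unfolding refines_def by (meson order_trans)

lemma refines_image_family:
  "refines \<U> \<V> \<Longrightarrow> refines (image_family f \<U>) (image_family f \<V>)"
  unfolding refines_def image_family_def by simp (meson image_mono)

lemma refines_star_family_left:
  assumes "cover_of X \<U>" "cover_of X \<V>"
  shows "refines \<U> (star_family \<U> \<V>)"
proof -
  have "U \<subseteq> star U \<V>" if "U \<in> \<U>" for U
    using that assms unfolding cover_of_def star_def by fastforce
  then show ?thesis
    unfolding refines_def star_family_def by blast
qed

text \<open>An element of \<open>\<V>\<close> meets some element of the cover \<open>\<U>\<close>, unless it is empty; an empty
  element still lies in a star, as \<open>\<U> \<noteq> {}\<close>.\<close>

lemma refines_star_family_right:
  assumes "cover_of X \<U>" "cover_of X \<V>" "\<U> \<noteq> {}"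
  shows "refines \<V> (star_family \<U> \<V>)"
  unfolding refines_def
proof
  fix V assume V: "V \<in> \<V>"
  obtain U where "U \<in> \<U>" "V = {} \<or> V \<inter> U \<noteq> {}"
    using V assms unfolding cover_of_def by blast
  then have "V \<subseteq> star U \<V>" "star U \<V> \<in> star_family \<U> \<V>"
    using V unfolding star_def star_family_def by auto
  then show "\<exists>W\<in>star_family \<U> \<V>. V \<subseteq> W" by blast
qed

lemma
  assumes "large_scale_structure X L"
  shows lss_cover: "\<U> \<in> L \<Longrightarrow> cover_of X \<U>"
    and lss_refine: "\<U> \<in> L \<Longrightarrow> cover_of X \<V> \<Longrightarrow> refines \<V> \<U> \<Longrightarrow> \<V> \<in> L"
    and lss_star: "\<U> \<in> L \<Longrightarrow> \<V> \<in> L \<Longrightarrow> star_family \<U> \<V> \<in> L"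
  using assms unfolding large_scale_structure_def by blast+

lemma lss_star_iter:
  assumes "large_scale_structure X L" "\<U> \<in> L" "\<V> \<in> L"
  shows "(\<lambda>U. star_iter n U \<V>) ` \<U> \<in> L"
proof (induction n)
  case 0
  then show ?case using assms by simp
next
  case (Suc n)
  have "(\<lambda>U. star_iter (Suc n) U \<V>) ` \<U> = star_family ((\<lambda>U. star_iter n U \<V>) ` \<U>) \<V>"
    unfolding star_family_def by (simp add: image_image)
  then show ?case using lss_star[OF assms(1) Suc assms(3)] by simp
qed

section \<open>Metrizability and countable generation\<close>

text \<open>The levels start at \<open>1\<close> for distinct points.  This gives the triangle inequality without
  exponential weights: \<open>max i j + 2 \<le> (i + 1) + (j + 1)\<close>.\<close>

lemma metric_of_levels:
  fixes R :: "nat \<Rightarrow> 'a \<Rightarrow> 'a \<Rightarrow> bool"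
  assumes sym: "\<And>k x y. R k x y \<Longrightarrow> R k y x"
    and mono: "\<And>i k x y. R i x y \<Longrightarrow> i \<le> k \<Longrightarrow> R k x y"
    and compose: "\<And>k x y z. R k x y \<Longrightarrow> R k y z \<Longrightarrow> R (Suc k) x z"
  shows "\<exists>d. infty_metric_on X d \<and>
           (\<forall>k x y. d x y \<le> of_nat (Suc k) \<longleftrightarrow> x = y \<or> R k x y)"
proof -
  define d :: "'a \<Rightarrow> 'a \<Rightarrow> ennreal" where
    "d x y = (if x = y then 0
              else if \<exists>k. R k x y then of_nat (Suc (LEAST k. R k x y)) else \<infinity>)" for x y
  have level: "d x y \<le> of_nat (Suc k) \<longleftrightarrow> x = y \<or> R k x y" for k x y
  proof (cases "x \<noteq> y \<and> (\<exists>k. R k x y)")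
    case True
    then have least: "R (LEAST k. R k x y) x y" by (auto intro: LeastI_ex)
    have "d x y \<le> of_nat (Suc k) \<longleftrightarrow> (LEAST k. R k x y) \<le> k"
      using True unfolding d_def by (auto simp del: of_nat_Suc)
    also have "\<dots> \<longleftrightarrow> R k x y"
      using least mono by (blast intro: Least_le)
    finally show ?thesis using True by blast
  next
    case False
    then show ?thesis unfolding d_def by (auto simp: top_unique simp del: of_nat_Suc)
  qed
  have attained: "\<exists>i. d x y = of_nat (Suc i)" if "x \<noteq> y" "d x y \<noteq> \<infinity>" for x y
  proof (cases "\<exists>k. R k x y")
    case True
    then have "d x y = of_nat (Suc (LEAST k. R k x y))"
      using that(1) by (simp only: d_def if_True if_False simp_thms)
    then show ?thesis by blast
  next
    case False
    then show ?thesis using that by (simp only: d_def if_True if_False simp_thms)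
  qed
  have triangle: "d x z \<le> d x y + d y z" for x y z
  proof (cases "x = y \<or> y = z \<or> d x y = \<infinity> \<or> d y z = \<infinity>")
    case True
    then show ?thesis
    proof (elim disjE)
      assume "x = y" then show ?thesis by (simp add: d_def)
    next
      assume "y = z" then show ?thesis by (simp add: d_def)
    qed simp_all
  next
    case False
    then obtain i j where ij: "d x y = of_nat (Suc i)" "d y z = of_nat (Suc j)"
      using attained by meson
    then have "R i x y" "R j y z"
      using False level[of x y i] level[of y z j] by auto
    then have "R (Suc (max i j)) x z"
      by (meson compose mono max.cobounded1 max.cobounded2)
    then have "d x z \<le> of_nat (Suc (Suc (max i j)))" using level by blast
    also have "\<dots> \<le> of_nat (Suc i + Suc j)" by (rule of_nat_mono) simp
    finally show ?thesis unfolding ij of_nat_add .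
  qed
  have "R k x y = R k y x" for k x y using sym by blast
  then have "d x y = d y x" for x y unfolding d_def by auto
  moreover have "d x y = 0 \<longleftrightarrow> x = y" for x y
    unfolding d_def by (simp del: of_nat_Suc)
  ultimately have "infty_metric_on X d"
    unfolding infty_metric_on_def using triangle by blast
  then show ?thesis using level by blast
qed

lemma infty_diameter_le_iff:
  "infty_diameter d A \<le> c \<longleftrightarrow> (\<forall>x\<in>A. \<forall>y\<in>A. d x y \<le> c)"
  unfolding infty_diameter_def by (simp add: SUP_le_iff)

lemma finite_ennreal_le_of_nat:
  assumes "(c :: ennreal) < \<infinity>"
  obtains k where "c \<le> of_nat k"
proof -
  obtain k where "c < of_nat k"
    using assms ennreal_Ex_less_of_nat[of c] by auto
  then show thesis using that less_imp_le by blast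
qed

text \<open>The empty set has diameter \<open>0\<close>, so it belongs to every cover by all sets of diameter at most
  \<open>k\<close>; this keeps the covers \<open>C k\<close> nonempty even over an empty carrier, where \<open>{}\<close> and \<open>{{}}\<close> are
  different covers.\<close>

lemma metrizable_imp_countably_generated:
  assumes "lss_metrizable X L"
  obtains C :: "nat \<Rightarrow> 'a set set" where
    "\<And>k. C k \<in> L" "\<And>k. C k \<noteq> {}" "\<And>\<U>. \<U> \<in> L \<Longrightarrow> \<exists>k. refines \<U> (C k)"
proof -
  obtain d where d: "infty_metric_on X d" and
    L: "\<And>\<U>. \<U> \<in> L \<longleftrightarrow> cover_of X \<U> \<and> (\<exists>c<\<infinity>. \<forall>U\<in>\<U>. infty_diameter d U \<le> c)"
    using assms unfolding lss_metrizable_def by blast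
  define C where "C k = {A. A \<subseteq> X \<and> infty_diameter d A \<le> of_nat k}" for k :: nat
  have "{x} \<in> C k" if "x \<in> X" for x k
  proof -
    have "d x x = 0" using that d unfolding infty_metric_on_def by blast
    then show ?thesis using that unfolding C_def infty_diameter_le_iff by simp
  qed
  then have "cover_of X (C k)" for k
    unfolding cover_of_def by (auto simp: C_def)
  moreover have "\<forall>U\<in>C k. infty_diameter d U \<le> of_nat k" "of_nat k < (\<infinity> :: ennreal)" for k
    unfolding C_def by (auto simp: of_nat_less_top)
  ultimately have CL: "C k \<in> L" for k
    unfolding L by blast
  have ne: "C k \<noteq> {}" for k
    unfolding C_def infty_diameter_le_iff by blast
  have "\<exists>k. refines \<U> (C k)" if U: "\<U> \<in> L" for \<U>
  proof -
    obtain c where c: "c < \<infinity>" "\<forall>U\<in>\<U>. infty_diameter d U \<le> c" and cov: "cover_of X \<U>"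
      using U unfolding L by blast
    obtain k where "c \<le> of_nat k" using c(1) finite_ennreal_le_of_nat by blast
    then have "\<U> \<subseteq> C k"
      using c(2) cov unfolding C_def cover_of_def by (auto intro: order_trans)
    then show ?thesis unfolding refines_def by blast
  qed
  then show thesis using that CL ne by blast
qed

text \<open>The covers \<open>E k\<close> absorb both the given cofinal sequence and the stars of their predecessors, so
  they are cofinal and their levels compose.  The metric only sees pairs of points; a set all of
  whose points are pairwise of level \<open>k\<close> lies in one element of \<open>st(E k, E k)\<close>, and so bounded
  diameter gives back a refinement of a single uniformly bounded cover.\<close>

lemma countably_generated_imp_metrizable:
  assumes lss: "large_scale_structure X L"
    and CL: "\<And>k. C k \<in> L" and Cne: "\<And>k. C k \<noteq> {}"
    and cofinal: "\<And>\<U>. \<U> \<in> L \<Longrightarrow> \<exists>k :: nat. refines \<U> (C k)"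
  shows "lss_metrizable X L"
proof -
  define E where "E = rec_nat (C 0) (\<lambda>k \<E>. star_family (star_family \<E> \<E>) (C k))"
  have E0: "E 0 = C 0"
    and ESuc: "\<And>k. E (Suc k) = star_family (star_family (E k) (E k)) (C k)"
    unfolding E_def by simp_all
  have EL: "E k \<in> L" for k
    by (induction k) (simp_all add: E0 ESuc CL lss_star[OF lss])
  have Ene: "E k \<noteq> {}" for k
    by (induction k) (simp_all add: E0 ESuc Cne star_family_def)
  have star_step: "refines (star_family (E k) (E k)) (E (Suc k))" for k
    unfolding ESuc by (metis refines_star_family_left lss_cover[OF lss] lss_star[OF lss] EL CL)
  have C_step: "refines (C k) (E (Suc k))" for k
    unfolding ESuc
  proof (rule refines_star_family_right)
    show "cover_of X (star_family (E k) (E k))" "cover_of X (C k)"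
      using lss_cover[OF lss] lss_star[OF lss] EL CL by blast+
    show "star_family (E k) (E k) \<noteq> {}" using Ene by (simp add: star_family_def)
  qed
  have E_cover: "cover_of X (E k)" for k
    by (rule lss_cover[OF lss EL])
  have E_step: "refines (E k) (E (Suc k))" for k
    by (rule refines_trans[OF refines_star_family_left[OF E_cover E_cover] star_step])
  define R where "R k x y \<longleftrightarrow> (\<exists>U\<in>E k. x \<in> U \<and> y \<in> U)" for k x y
  have R_Suc: "R (Suc k) x y" if R: "R k x y" for k x y
  proof -
    obtain U where U: "U \<in> E k" "x \<in> U" "y \<in> U" using R unfolding R_def by blast
    then obtain W where "W \<in> E (Suc k)" "U \<subseteq> W"
      using E_step[of k] unfolding refines_def by blast
    then show ?thesis using U unfolding R_def by blast
  qed
  have mono: "R k x y" if "R i x y" "i \<le> k" for i k x y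
    using that(2,1) by (induction k rule: dec_induct) (auto intro: R_Suc)
  have compose: "R (Suc k) x z" if "R k x y" "R k y z" for k x y z
  proof -
    obtain U V where UV: "U \<in> E k" "V \<in> E k" "x \<in> U" "y \<in> U" "y \<in> V" "z \<in> V"
      using \<open>R k x y\<close> \<open>R k y z\<close> unfolding R_def by blast
    then have "x \<in> star U (E k)" "z \<in> star U (E k)" unfolding star_def by auto
    moreover have "star U (E k) \<in> star_family (E k) (E k)"
      using UV(1) unfolding star_family_def by (rule imageI)
    then obtain W where "W \<in> E (Suc k)" "star U (E k) \<subseteq> W"
      using star_step[of k] unfolding refines_def by meson
    ultimately show ?thesis unfolding R_def by blast
  qed
  have sym: "R k y x" if "R k x y" for k x y
    using that unfolding R_def by blast
  have "\<exists>d. infty_metric_on X d \<and>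
          (\<forall>k x y. d x y \<le> of_nat (Suc k) \<longleftrightarrow> x = y \<or> R k x y)"
  proof (rule metric_of_levels[of R X])
    show "R k y x" if "R k x y" for k x y using that by (rule sym)
    show "R k x y" if "R i x y" "i \<le> k" for i k x y using that by (rule mono)
    show "R (Suc k) x z" if "R k x y" "R k y z" for k x y z using that by (rule compose)
  qed
  then obtain d where metric: "infty_metric_on X d"
    and level: "\<And>k x y. d x y \<le> of_nat (Suc k) \<longleftrightarrow> x = y \<or> R k x y"
    by blast
  have "\<U> \<in> L \<longleftrightarrow> cover_of X \<U> \<and> (\<exists>c<\<infinity>. \<forall>U\<in>\<U>. infty_diameter d U \<le> c)" for \<U>
  proof (intro iffI conjI; (elim conjE exE)?)
    assume U: "\<U> \<in> L"
    then show "cover_of X \<U>" by (rule lss_cover[OF lss])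
    obtain k where "refines \<U> (C k)" using cofinal[OF U] by blast
    then have ref: "refines \<U> (E (Suc k))" using C_step by (rule refines_trans)
    have "R (Suc k) x y" if xy: "U \<in> \<U>" "x \<in> U" "y \<in> U" for U x y
    proof -
      obtain W where "W \<in> E (Suc k)" "U \<subseteq> W"
        using ref xy(1) unfolding refines_def by meson
      then show ?thesis using xy unfolding R_def by blast
    qed
    then have "\<forall>U\<in>\<U>. infty_diameter d U \<le> of_nat (Suc (Suc k))"
      unfolding infty_diameter_le_iff level by blast
    moreover have "of_nat (Suc (Suc k)) < (\<infinity> :: ennreal)"
      unfolding infinity_ennreal_def by (rule of_nat_less_top)
    ultimately show "\<exists>c<\<infinity>. \<forall>U\<in>\<U>. infty_diameter d U \<le> c" by blast
  next
    fix c assume cov: "cover_of X \<U>" and c: "c < \<infinity>" "\<forall>U\<in>\<U>. infty_diameter d U \<le> c"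
    obtain k where "c \<le> of_nat k" using c(1) finite_ennreal_le_of_nat by blast
    also have "of_nat k \<le> (of_nat (Suc k) :: ennreal)" by (rule of_nat_mono) simp
    finally have close: "x = y \<or> R k x y" if "U \<in> \<U>" "x \<in> U" "y \<in> U" for U x y
      using c(2) that unfolding infty_diameter_le_iff level[symmetric] by (meson order_trans)
    have "refines \<U> (star_family (E k) (E k))"
      unfolding refines_def
    proof
      fix U assume U: "U \<in> \<U>"
      \<comment> \<open>Any element of \<open>E k\<close> through a point of \<open>U\<close> serves as centre of the star.\<close>
      obtain W where W: "W \<in> E k" "U = {} \<or> W \<inter> U \<noteq> {}"
      proof (cases "U = {}")
        case True
        moreover obtain W where "W \<in> E k" using Ene[of k] by blast
        ultimately show thesis by (intro that) simp_all
      next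
        case False
        then obtain x where "x \<in> U" by blast
        then have "x \<in> \<Union>(E k)"
          using U cov E_cover[of k] unfolding cover_of_def by blast
        then obtain W where "W \<in> E k" "x \<in> W" by blast
        then show thesis using \<open>x \<in> U\<close> by (intro that) auto
      qed
      have "U \<subseteq> star W (E k)"
      proof
        fix y assume y: "y \<in> U"
        then obtain x where x: "x \<in> W" "x \<in> U" using W(2) by blast
        then have "R k x y" using close[OF U x(2) y] W(1) unfolding R_def by blast
        then show "y \<in> star W (E k)" using x(1) unfolding R_def star_def by blast
      qed
      then show "\<exists>W\<in>star_family (E k) (E k). U \<subseteq> W"
        using W(1) unfolding star_family_def by blast
    qed
    then show "\<U> \<in> L" by (rule lss_refine[OF lss lss_star[OF lss EL EL] cov])
  qed
  then show ?thesis unfolding lss_metrizable_def using metric by blast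
qed

section \<open>Transfer along the map\<close>

theorem theorem1p2:
  fixes X :: "'a set" and Y :: "'b set"
    and LX :: "'a set set set" and LY :: "'b set set set"
    and f :: "'a \<Rightarrow> 'b" and n :: nat
  assumes "large_scale_structure X LX"
    and "large_scale_structure Y LY"
    and "n \<ge> 1"
    and "f \<in> X \<rightarrow> Y"
    and "coarse_map LX LY f"
    and "coarsely_n_to_1 n X LX LY f"
    and star_property:
      "\<forall>\<U>\<in>LY. \<exists>\<V>\<in>LX. \<forall>U\<in>\<U>. \<exists>V :: nat \<Rightarrow> 'a set.
         \<forall>i\<in>{1..n}. V i \<in> \<V> \<and> U \<subseteq> star_iter n (f ` V i) (image_family f \<V>)"
    and "lss_metrizable X LX"
  shows "lss_metrizable Y LY"
proof -
  obtain C where CL: "\<And>k. C k \<in> LX" and Cne: "\<And>k. C k \<noteq> {}"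
    and cofinal: "\<And>\<V>. \<V> \<in> LX \<Longrightarrow> \<exists>k :: nat. refines \<V> (C k)"
    using metrizable_imp_countably_generated[OF \<open>lss_metrizable X LX\<close>] by blast
  have "\<forall>k. \<exists>\<B>. \<B> \<in> LY \<and> refines (image_family f (C k)) \<B>"
    using \<open>coarse_map LX LY f\<close> CL unfolding coarse_map_def by blast
  from choice[OF this]
  obtain B where BL: "\<And>k. B k \<in> LY" and fC: "\<And>k. refines (image_family f (C k)) (B k)"
    by blast
  define D where "D k = (\<lambda>U. star_iter n U (B k)) ` B k" for k
  show ?thesis
  proof (rule countably_generated_imp_metrizable[where C = D])
    show "large_scale_structure Y LY" by fact
    show "D k \<in> LY" for k
      unfolding D_def using lss_star_iter \<open>large_scale_structure Y LY\<close> BL by blast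
    show "D k \<noteq> {}" for k
    proof -
      obtain V where "V \<in> C k" using Cne[of k] by blast
      then show ?thesis using fC[of k] unfolding D_def refines_def image_family_def by auto
    qed
    show "\<exists>k. refines \<U> (D k)" if U: "\<U> \<in> LY" for \<U>
    proof -
      obtain \<V> where V: "\<V> \<in> LX" and
        "\<forall>U\<in>\<U>. \<exists>V :: nat \<Rightarrow> 'a set.
           \<forall>i\<in>{1..n}. V i \<in> \<V> \<and> U \<subseteq> star_iter n (f ` V i) (image_family f \<V>)"
        using bspec[OF star_property U] by blast
      then have inside: "\<exists>V\<in>\<V>. U \<subseteq> star_iter n (f ` V) (image_family f \<V>)" if "U \<in> \<U>" for U
        using that \<open>n \<ge> 1\<close> by (meson atLeastAtMost_iff order_refl)
      obtain k where "refines \<V> (C k)" using cofinal[OF V] by blast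
      then have fV: "refines (image_family f \<V>) (B k)"
        by (rule refines_trans[OF refines_image_family fC])
      have "\<exists>W\<in>D k. U \<subseteq> W" if U_in: "U \<in> \<U>" for U
      proof -
        obtain V where V: "V \<in> \<V>" "U \<subseteq> star_iter n (f ` V) (image_family f \<V>)"
          using inside[OF U_in] by blast
        then obtain W where W: "W \<in> B k" "f ` V \<subseteq> W"
          using fV unfolding refines_def image_family_def by auto
        then have "U \<subseteq> star_iter n W (B k)"
          using V(2) star_iter_mono[OF W(2) fV] by blast
        then show ?thesis using W(1) unfolding D_def by blast
      qed
      then show ?thesis unfolding refines_def by blast
    qed
  qed
qed

end
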